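(* Let $f$ and $g$ be transcendental entire functions. Then: (1) $f(AV(g))\subset AV(f\circ g)$; (2) $g(CP(f\circ g))\subset CP(f)\cup CV(g)$.
   Context: For an entire function $h$: $CP(h)=\{z\in\mathbb{C}: h'(z)=0\}$ is the set of critical points; $CV(h)=h(CP(h))$ is the set of critical values; a point $\zeta\in\mathbb{C}$ is an asymptotic value of $h$ if there exists a curve $\Gamma$ tending to infinity such that $h(z)\to\zeta$ as $z\to\infty$ along $\Gamma$, and $AV(h)\subset\mathbb{C}$ is the set of all asymptotic values of $h$. *)

theory Defs
  imports "HOL-Complex_Analysis.Complex_Analysis" "HOL-Computational_Algebra.Polynomial"
begin

definition transcendental_entire :: "(complex \<Rightarrow> complex) \<Rightarrow> bool" where
  "transcendental_entire h \<longleftrightarrow>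
     h holomorphic_on UNIV \<and> \<not> (\<exists>p :: complex poly. \<forall>z. h z = poly p z)"

definition critical_points :: "(complex \<Rightarrow> complex) \<Rightarrow> complex set" where
  "critical_points h = {z. deriv h z = 0}"

definition critical_values :: "(complex \<Rightarrow> complex) \<Rightarrow> complex set" where
  "critical_values h = h ` critical_points h"

(* A curve tending to infinity is a continuous map on [0, \<infinity>) leaving every bounded set;
   its values at negative parameters are irrelevant. Since such a curve is bounded on every
   [0, T], "h(z) tends to \<zeta> as z tends to infinity along the curve" amounts to convergence
   in the parameter. *)
definition asymptotic_values :: "(complex \<Rightarrow> complex) \<Rightarrow> complex set" where
  "asymptotic_values h =
     {\<zeta>. \<exists>\<gamma> :: real \<Rightarrow> complex. continuous_on {0..} \<gamma> \<and>
            filterlim \<gamma> at_infinity at_top \<and> ((\<lambda>t. h (\<gamma> t)) \<longlongrightarrow> \<zeta>) at_top}"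

end

theory Submission
  imports Defs
begin

text \<open>Both inclusions are formal consequences of composing. A curve along which
  \<open>g\<close> tends to \<zeta> also serves \<open>f \<circ> g\<close>: continuity of
  \<open>f\<close> turns the limit \<zeta> into \<open>f \<zeta>\<close>
  (\<open>image_asymptotic_values_subset\<close>). By the chain rule the derivative of
  \<open>f \<circ> g\<close> is a product, and a product of complex numbers vanishes only if one of
  its factors does (\<open>image_critical_points_compose_subset\<close>). Of transcendental entire
  functions, the argument uses holomorphy on the whole plane.\<close>

lemma image_asymptotic_values_subset:
  assumes "continuous_on UNIV f"
  shows "f ` asymptotic_values g \<subseteq> asymptotic_values (f \<circ> g)"
proof
  fix w assume "w \<in> f ` asymptotic_values g"
  then obtain \<zeta> and \<gamma> :: "real \<Rightarrow> complex" where "w = f \<zeta>" and \<gamma>: "continuous_on {0..} \<gamma>"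
      "filterlim \<gamma> at_infinity at_top" and lim: "((\<lambda>t. g (\<gamma> t)) \<longlongrightarrow> \<zeta>) at_top"
    unfolding asymptotic_values_def by blast
  \<comment> \<open>Asymptotic values are finite by definition, so \<zeta> is a point of the plane
    and continuity of \<open>f\<close> applies there.\<close>
  have "isCont f \<zeta>"
    using assms by (simp add: continuous_on_eq_continuous_at)
  then have "((\<lambda>t. (f \<circ> g) (\<gamma> t)) \<longlongrightarrow> w) at_top"
    using isCont_tendsto_compose[OF _ lim] \<open>w = f \<zeta>\<close> by simp
  with \<gamma> show "w \<in> asymptotic_values (f \<circ> g)"
    unfolding asymptotic_values_def by blast
qed

lemma image_critical_points_compose_subset:
  assumes "f holomorphic_on UNIV" and "g holomorphic_on UNIV"
  shows "g ` critical_points (f \<circ> g) \<subseteq> critical_points f \<union> critical_values g"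
proof
  fix w assume "w \<in> g ` critical_points (f \<circ> g)"
  then obtain z where z: "w = g z" "deriv (f \<circ> g) z = 0"
    unfolding critical_points_def by blast
  have "deriv (f \<circ> g) z = deriv f (g z) * deriv g z"
    using assms by (intro deriv_chain) (auto intro: holomorphic_on_imp_differentiable_at)
  \<comment> \<open>If the factor \<open>deriv f (g z)\<close> vanishes, \<open>g z\<close> is
    itself a critical point of \<open>f\<close>; if \<open>deriv g z\<close> does, \<open>z\<close>
    is a critical point of \<open>g\<close> and \<open>g z\<close> is its critical value.\<close>
  with z show "w \<in> critical_points f \<union> critical_values g"
    by (auto simp: critical_points_def critical_values_def)
qed

theorem theorem2p6:
  fixes f g :: "complex \<Rightarrow> complex"
  assumes "transcendental_entire f" and "transcendental_entire g"
  shows "f ` asymptotic_values g \<subseteq> asymptotic_values (f \<circ> g) \<and>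
         g ` critical_points (f \<circ> g) \<subseteq> critical_points f \<union> critical_values g"
  using assms image_asymptotic_values_subset image_critical_points_compose_subset
  by (simp add: transcendental_entire_def holomorphic_on_imp_continuous_on)

end
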